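(* Let $n\ge4$, $1\le m\le\lfloor n/2\rfloor$, let $W$ be the Coxeter group of type $D_n$, and let $w=(m,m-1,\dots,2,\overline1)(n,n-1,\dots,m+2,\overline{m+1})\in W$. Let $w_0$ be a divisor of $w$ of type II or III, i.e. $w_0=w(i,j)$ or $w_0=w(\overline i,\overline j)$ with $1\le i<j\le m$ (type II) or $m+1\le i<j\le n$ (type III). Write $w_0$ as a product of three disjoint marked cycles (including $1$-cycles) $x=(x_1,\dots,x_p)$, $y=(y_1,\dots,y_q)$, $z=(z_1,\dots,z_r)$ with $p+q+r=n$, where $z$ has an even number of overlined entries, and $x$, $y$ each have exactly one overlined entry, placed last: $x_p=\overline u$, $y_q=\overline v$; if one of the two cycles with a single overlined entry contains $n$ or $\overline n$, it is named $x$. Then a reduced decomposition of $w_0$ over the set $T$ of reflections of $W$ is the product $(u,v)(\overline u,\overline v)$ followed by the reflections used in the type II/III procedure, in reverse order.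
   Context: $W$ is the group of $n\times n$ monomial matrices whose nonzero entries are $\pm1$ with product $1$. A marked cycle $(x_1,\dots,x_k)$, each $x_a$ being $p_a$ or $\overline{p_a}$ with $p_1,\dots,p_k\in\{1,\dots,n\}$ distinct, means that row $p_a$ has its nonzero entry in column $p_{a+1}$ (indices mod $k$), equal to $-1$ if $x_a$ is overlined and to $1$ otherwise; a $1$-cycle $(\overline p)$ means diagonal entry $-1$ in position $p$. Elements are written as products of disjoint marked cycles. The set of reflections is $T=\{(i,j),(\overline i,\overline j):1\le i\neq j\le n\}$, with $(i,j)=(j,i)$ and $(\overline i,\overline j)=(\overline j,\overline i)$. $\ell_T(v)$ is the least number of elements of $T$ whose product is $v$; a decomposition of $v$ as a product of $\ell_T(v)$ elements of $T$ is called reduced. Every $w_0$ of type II or III is a product of three disjoint marked cycles, exactly one of which has an even number (possibly $0$) of overlined entries; each of the other two has exactly one overlined entry and can be written with that entry last. Reflections of a cycle: for a marked cycle $(c_1,\dots,c_k)$ with underlying numbers $p_1,\dots,p_k$, the reflections used, in order $a=1,\dots,k-1$, are $(p_a,p_{a+1})$ if $c_a$ is not overlined and $(\overline{p_a},\overline{p_{a+1}})$ if $c_a$ is overlined (none if $k=1$). Type II/III procedure: use first (Step 1) the reflections of the cycle $z$, then (Step 2) those of $x$, then (Step 3) those of $y$, each reflection being applied by right multiplication. *)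

theory Defs
  imports Complex_Main "Jordan_Normal_Form.Matrix"
begin

text \<open>Matrices are \<^typ>\<open>real mat\<close> of dimension \<open>n \<times> n\<close>. Positions \<open>1, \<dots>, n\<close> are natural
  numbers starting at 1, whereas matrix entries are addressed from 0, so position \<open>p\<close> is row
  (or column) \<open>p - 1\<close>.\<close>

definition monomial_mat :: "nat \<Rightarrow> real mat \<Rightarrow> bool" where
  "monomial_mat n A \<longleftrightarrow> A \<in> carrier_mat n n \<and>
     (\<forall>i<n. \<exists>!j. j < n \<and> A $$ (i, j) \<noteq> 0) \<and>
     (\<forall>j<n. \<exists>!i. i < n \<and> A $$ (i, j) \<noteq> 0)"

definition nonzero_positions :: "nat \<Rightarrow> real mat \<Rightarrow> (nat \<times> nat) set" where
  "nonzero_positions n A = {ij \<in> {..<n} \<times> {..<n}. A $$ ij \<noteq> 0}"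

text \<open>The Coxeter group of type \<open>D\<^sub>n\<close>, as the monomial matrices with nonzero entries
  \<open>1\<close> or \<open>-1\<close> whose product is \<open>1\<close>.\<close>

definition W_D :: "nat \<Rightarrow> real mat set" where
  "W_D n = {A. monomial_mat n A \<and>
     (\<forall>ij \<in> nonzero_positions n A. A $$ ij = 1 \<or> A $$ ij = -1) \<and>
     (\<Prod>ij \<in> nonzero_positions n A. A $$ ij) = 1}"

text \<open>\<open>Plain p\<close> stands for the entry \<open>p\<close> and \<open>Over p\<close> for the overlined entry of a marked cycle.\<close>

datatype entry = Plain (num: nat) | Over (num: nat)

fun overlined :: "entry \<Rightarrow> bool" where
  "overlined (Plain p) = False"
| "overlined (Over p) = True"

definition support :: "entry list \<Rightarrow> nat set" where
  "support c = num ` set c"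

definition marked_cycle :: "nat \<Rightarrow> entry list \<Rightarrow> bool" where
  "marked_cycle n c \<longleftrightarrow> c \<noteq> [] \<and> distinct (map num c) \<and> support c \<subseteq> {1..n}"

definition num_overlined :: "entry list \<Rightarrow> nat" where
  "num_overlined c = length (filter overlined c)"

text \<open>Row \<open>p\<^sub>a\<close> has its nonzero entry in column \<open>p\<^sub>a\<^sub>+\<^sub>1\<close> (indices modulo the length of the
  cycle); rows outside the support are those of the identity.\<close>

definition cycle_mat :: "nat \<Rightarrow> entry list \<Rightarrow> real mat" where
  "cycle_mat n c = mat n n (\<lambda>(i, j).
     let p = i + 1; q = j + 1 in
     if p \<notin> support c then (if p = q then 1 else 0)
     else if \<exists>a<length c. c ! a = Plain p \<and> num (c ! ((a + 1) mod length c)) = q then 1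
     else if \<exists>a<length c. c ! a = Over p \<and> num (c ! ((a + 1) mod length c)) = q then -1
     else 0)"

definition reflection :: "nat \<Rightarrow> nat \<Rightarrow> nat \<Rightarrow> real mat" where
  "reflection n i j = cycle_mat n [Plain i, Plain j]"

definition reflection_bar :: "nat \<Rightarrow> nat \<Rightarrow> nat \<Rightarrow> real mat" where
  "reflection_bar n i j = cycle_mat n [Over i, Over j]"

definition reflections :: "nat \<Rightarrow> real mat set" where
  "reflections n =
     {reflection n i j |i j. i \<in> {1..n} \<and> j \<in> {1..n} \<and> i \<noteq> j} \<union>
     {reflection_bar n i j |i j. i \<in> {1..n} \<and> j \<in> {1..n} \<and> i \<noteq> j}"

definition word_prod :: "nat \<Rightarrow> real mat list \<Rightarrow> real mat" where
  "word_prod n ts = foldr (*) ts (1\<^sub>m n)"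

definition reflection_length :: "nat \<Rightarrow> real mat \<Rightarrow> nat" where
  "reflection_length n v =
     (LEAST k. \<exists>ts. set ts \<subseteq> reflections n \<and> word_prod n ts = v \<and> length ts = k)"

definition reduced_decomposition :: "nat \<Rightarrow> real mat \<Rightarrow> real mat list \<Rightarrow> bool" where
  "reduced_decomposition n v ts \<longleftrightarrow> v \<in> W_D n \<and> set ts \<subseteq> reflections n \<and>
     word_prod n ts = v \<and> length ts = reflection_length n v"

text \<open>The element \<open>w\<close>: \<open>rev [2..<m + 1]\<close> is the list \<open>m, m - 1, \<dots>, 2\<close>.\<close>

definition w_elem :: "nat \<Rightarrow> nat \<Rightarrow> real mat" where
  "w_elem n m =
     cycle_mat n (map Plain (rev [2..<m + 1]) @ [Over 1]) *
     cycle_mat n (map Plain (rev [m + 2..<n + 1]) @ [Over (m + 1)])"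

definition type_II :: "nat \<Rightarrow> nat \<Rightarrow> real mat \<Rightarrow> bool" where
  "type_II n m w0 \<longleftrightarrow> (\<exists>i j. 1 \<le> i \<and> i < j \<and> j \<le> m \<and>
     (w0 = w_elem n m * reflection n i j \<or> w0 = w_elem n m * reflection_bar n i j))"

definition type_III :: "nat \<Rightarrow> nat \<Rightarrow> real mat \<Rightarrow> bool" where
  "type_III n m w0 \<longleftrightarrow> (\<exists>i j. m + 1 \<le> i \<and> i < j \<and> j \<le> n \<and>
     (w0 = w_elem n m * reflection n i j \<or> w0 = w_elem n m * reflection_bar n i j))"

definition cycle_reflections :: "nat \<Rightarrow> entry list \<Rightarrow> real mat list" where
  "cycle_reflections n c = map (\<lambda>a.
     if overlined (c ! a) then reflection_bar n (num (c ! a)) (num (c ! (a + 1)))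
     else reflection n (num (c ! a)) (num (c ! (a + 1)))) [0..<length c - 1]"

text \<open>In the order of use: first those of \<open>z\<close>, then those of \<open>x\<close>, then those of \<open>y\<close>, each applied
  by right multiplication. Applied to \<open>w0\<close> they lead to the element with \<open>-1\<close> at the two
  positions \<open>u\<close> and \<open>v\<close>, hence the reversed order in a decomposition of \<open>w0\<close>.\<close>

definition procedure_reflections ::
    "nat \<Rightarrow> entry list \<Rightarrow> entry list \<Rightarrow> entry list \<Rightarrow> real mat list" where
  "procedure_reflections n x y z =
     cycle_reflections n z @ cycle_reflections n x @ cycle_reflections n y"

end

theory Submission
  imports Defs "Jordan_Normal_Form.Determinant" "HOL-Combinatorics.Permutations"
begin

text \<open>Multiplying the reflections of a marked cycle in reverse order gives back the cycle, except that
  the sign of its last row is the product of the other signs; this changes the sign exactly if the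
  number of overlined entries is odd. The factor \<open>(u,v)(bar u, bar v)\<close>, which is \<open>-1\<close> at \<open>u\<close> and \<open>v\<close>, corrects
  this for \<open>x\<close> and \<open>y\<close>, so the product is \<open>w\<^sub>0\<close> and has \<open>n - 1\<close> factors. It is reduced: a product of
  \<open>k\<close> reflections fixes the common kernel of \<open>k\<close> linear functionals, whereas a vector fixed by \<open>w\<^sub>0\<close>
  vanishes on \<open>x\<close> and \<open>y\<close> and is determined on \<open>z\<close> by its coordinate at the last entry of \<open>z\<close>, so
  that \<open>k + 1 \<ge> n\<close>.\<close>

section \<open>Matrices traced through signed unit rows\<close>

text \<open>Positions count from 1, whereas \<open>row\<close> and \<open>unit_vec\<close> count
  from 0. Describing a matrix by such rows lets products be computed by following one position at a
  time.\<close>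

definition row_at :: "nat \<Rightarrow> real mat \<Rightarrow> nat \<Rightarrow> real \<Rightarrow> nat \<Rightarrow> bool" where
  "row_at n A p s q \<longleftrightarrow> A \<in> carrier_mat n n \<and> p \<in> {1..n} \<and> q \<in> {1..n} \<and>
     row A (p - 1) = s \<cdot>\<^sub>v unit_vec n (q - 1)"

lemma row_at_one: "p \<in> {1..n} \<Longrightarrow> row_at n (1\<^sub>m n) p 1 p"
  unfolding row_at_def by auto

lemma row_at_index:
  assumes "row_at n A p s q" "j \<in> {1..n}"
  shows "A $$ (p - 1, j - 1) = (if j = q then s else 0)"
proof -
  have "p - 1 < dim_row A" "j - 1 < dim_col A"
    using assms by (auto simp: row_at_def)
  then have "A $$ (p - 1, j - 1) = row A (p - 1) $ (j - 1)" by simp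
  also have "\<dots> = (s \<cdot>\<^sub>v unit_vec n (q - 1)) $ (j - 1)"
    using assms by (simp add: row_at_def)
  also have "\<dots> = (if j = q then s else 0)"
  proof -
    \<comment> \<open>Truncated subtraction loses nothing here, because both positions are at least
      1.\<close>
    have "j - 1 = q - 1 \<longleftrightarrow> j = q" "j - 1 < n" "q - 1 < n"
      using assms by (auto simp: row_at_def)
    then show ?thesis by (simp add: unit_vec_def)
  qed
  finally show ?thesis .
qed

lemma row_atI:
  assumes "A \<in> carrier_mat n n" "p \<in> {1..n}" "q \<in> {1..n}"
    and "\<And>j. j \<in> {1..n} \<Longrightarrow> A $$ (p - 1, j - 1) = (if j = q then s else 0)"
  shows "row_at n A p s q"
proof -
  have "row A (p - 1) = s \<cdot>\<^sub>v unit_vec n (q - 1)"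
  proof (rule eq_vecI)
    fix k assume k: "k < dim_vec (s \<cdot>\<^sub>v unit_vec n (q - 1))"
    then show "row A (p - 1) $ k = (s \<cdot>\<^sub>v unit_vec n (q - 1)) $ k"
      using assms(1-3) assms(4)[of "Suc k"] by (auto simp: unit_vec_def)
  qed (use assms in auto)
  then show ?thesis
    using assms by (simp add: row_at_def)
qed

lemma row_at_mult_vec:
  assumes "row_at n A p s q" "v \<in> carrier_vec n"
  shows "(A *\<^sub>v v) $ (p - 1) = s * v $ (q - 1)"
  using assms by (auto simp: row_at_def)

text \<open>Row \<open>p\<close> of \<open>A\<close> selects \<open>s\<close> times row
  \<open>q\<close> of \<open>B\<close>. A position is therefore traced through a product from left
  to right while the signs multiply.\<close>

lemma row_at_mult:
  assumes A: "row_at n A p s q" and B: "row_at n B q t r"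
  shows "row_at n (A * B) p (s * t) r"
proof (rule row_atI)
  fix j assume j: "j \<in> {1..n}"
  have "(A * B) $$ (p - 1, j - 1) = row A (p - 1) \<bullet> col B (j - 1)"
    using A B j by (auto simp: row_at_def)
  also have "\<dots> = s * (unit_vec n (q - 1) \<bullet> col B (j - 1))"
    using A B j by (auto simp: row_at_def)
  also have "unit_vec n (q - 1) \<bullet> col B (j - 1) = col B (j - 1) $ (q - 1)"
    using A B j by (intro scalar_prod_left_unit) (auto simp: row_at_def)
  also have "\<dots> = B $$ (q - 1, j - 1)"
    using A B j by (intro index_col) (auto simp: row_at_def)
  finally show "(A * B) $$ (p - 1, j - 1) = (if j = r then s * t else 0)"
    using row_at_index[OF B j] by simp
qed (use A B in \<open>auto simp: row_at_def\<close>)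

lemma row_at_eqI:
  assumes "A \<in> carrier_mat n n" "B \<in> carrier_mat n n"
    and rows: "\<And>p. p \<in> {1..n} \<Longrightarrow> \<exists>s q. row_at n A p s q \<and> row_at n B p s q"
  shows "A = B"
proof (rule eq_rowI)
  fix i assume "i < dim_row B"
  then have "Suc i \<in> {1..n}" using assms(2) by auto
  from rows[OF this] show "row A i = row B i"
    by (auto simp: row_at_def)
qed (use assms in auto)

section \<open>Rows of marked cycles and of reflections\<close>

definition entry_sign :: "entry \<Rightarrow> real" where
  "entry_sign e = (if overlined e then -1 else 1)"

lemma entry_sign_cases: "entry_sign e = 1 \<or> entry_sign e = -1"
  by (simp add: entry_sign_def)

lemma entry_sign_sq: "entry_sign e * entry_sign e = 1"
  by (simp add: entry_sign_def)

lemma cycle_mat_carrier [simp]: "cycle_mat n c \<in> carrier_mat n n"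
  by (simp add: cycle_mat_def)

text \<open>Since the numbers in \<open>c\<close> are distinct, only the index \<open>a\<close>
  itself can satisfy either existential in \<open>cycle_mat\<close>; the mark of
  \<open>c ! a\<close> decides which branch applies.\<close>

lemma row_at_cycle_mat:
  assumes c: "marked_cycle n c" and a: "a < length c"
  shows "row_at n (cycle_mat n c) (num (c ! a)) (entry_sign (c ! a))
           (num (c ! ((a + 1) mod length c)))"
proof -
  have len: "length c > 0" using a by (metis not_less_zero gr0I)
  have inj: "b = a" if "b < length c" "num (c ! b) = num (c ! a)" for b
    using c a that by (auto simp: marked_cycle_def distinct_conv_nth)
  have in_supp: "num (c ! b) \<in> support c" if "b < length c" for b
    using that by (auto simp: support_def)
  then have range: "num (c ! b) \<in> {1..n}" if "b < length c" for b
    using c in_supp[OF that] unfolding marked_cycle_def by blast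
  have b: "(a + 1) mod length c < length c" using len by simp
  show ?thesis
  proof (rule row_atI)
    fix j assume j: "j \<in> {1..n}"
    let ?q = "num (c ! ((a + 1) mod length c))"
    have plain: "(\<exists>b<length c. c ! b = Plain (num (c ! a)) \<and> num (c ! ((b + 1) mod length c)) = j)
        \<longleftrightarrow> \<not> overlined (c ! a) \<and> ?q = j"
    proof
      assume "\<not> overlined (c ! a) \<and> ?q = j"
      then show "\<exists>b<length c. c ! b = Plain (num (c ! a)) \<and> num (c ! ((b + 1) mod length c)) = j"
        using a by (intro exI[of _ a]) (cases "c ! a"; simp)
    next
      assume "\<exists>b<length c. c ! b = Plain (num (c ! a)) \<and> num (c ! ((b + 1) mod length c)) = j"
      then obtain b where b: "b < length c" "c ! b = Plain (num (c ! a))"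
          "num (c ! ((b + 1) mod length c)) = j" by blast
      moreover have "b = a" using inj[of b] b by simp
      ultimately show "\<not> overlined (c ! a) \<and> ?q = j" by (metis overlined.simps(1))
    qed
    have over: "(\<exists>b<length c. c ! b = Over (num (c ! a)) \<and> num (c ! ((b + 1) mod length c)) = j)
        \<longleftrightarrow> overlined (c ! a) \<and> ?q = j"
    proof
      assume "overlined (c ! a) \<and> ?q = j"
      then show "\<exists>b<length c. c ! b = Over (num (c ! a)) \<and> num (c ! ((b + 1) mod length c)) = j"
        using a by (intro exI[of _ a]) (cases "c ! a"; simp)
    next
      assume "\<exists>b<length c. c ! b = Over (num (c ! a)) \<and> num (c ! ((b + 1) mod length c)) = j"
      then obtain b where b: "b < length c" "c ! b = Over (num (c ! a))"
          "num (c ! ((b + 1) mod length c)) = j" by blast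
      moreover have "b = a" using inj[of b] b by simp
      ultimately show "overlined (c ! a) \<and> ?q = j" by (metis overlined.simps(2))
    qed
    have p1: "num (c ! a) - 1 + 1 = num (c ! a)" "num (c ! a) - 1 < n"
      using range[OF a] by auto
    have j1: "j - 1 + 1 = j" "j - 1 < n" using j by auto
    show "cycle_mat n c $$ (num (c ! a) - 1, j - 1) = (if j = ?q then entry_sign (c ! a) else 0)"
      using in_supp[OF a] p1(2) j1(2)
      unfolding cycle_mat_def
      by (simp only: index_mat case_prod_conv Let_def p1(1) j1(1) plain over)
         (auto simp: entry_sign_def)
  qed (use range[OF a] range[OF b] in simp_all)
qed

lemma row_at_cycle_mat_outside:
  assumes "p \<in> {1..n}" "p \<notin> support c"
  shows "row_at n (cycle_mat n c) p 1 p"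
  by (rule row_atI) (use assms in \<open>auto simp: cycle_mat_def\<close>)

text \<open>A common form of both kinds of reflection, chosen by the mark of the first entry. This
  is the shape in which reflections arise from consecutive entries of a cycle.\<close>

definition edge_reflection :: "nat \<Rightarrow> entry \<Rightarrow> nat \<Rightarrow> real mat" where
  "edge_reflection n e j =
     (if overlined e then reflection_bar n (num e) j else reflection n (num e) j)"

lemma edge_reflection_carrier [simp]: "edge_reflection n e j \<in> carrier_mat n n"
  by (simp add: edge_reflection_def reflection_def reflection_bar_def)

lemma reflections_eq:
  "reflections n = {edge_reflection n e j | e j. num e \<in> {1..n} \<and> j \<in> {1..n} \<and> num e \<noteq> j}"
  (is "_ = ?R")
proof
  have "reflection n i j = edge_reflection n (Plain i) j"
    "reflection_bar n i j = edge_reflection n (Over i) j" for i j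
    by (simp_all add: edge_reflection_def)
  then show "reflections n \<subseteq> ?R"
    unfolding reflections_def by (smt (verit) Un_iff entry.sel mem_Collect_eq subsetI)
  show "?R \<subseteq> reflections n"
    by (auto simp: reflections_def edge_reflection_def)
qed

lemma row_at_edge_reflection:
  assumes "num e \<in> {1..n}" "j \<in> {1..n}" "num e \<noteq> j"
  shows "row_at n (edge_reflection n e j) (num e) (entry_sign e) j"
    and "row_at n (edge_reflection n e j) j (entry_sign e) (num e)"
    and "p \<in> {1..n} \<Longrightarrow> p \<noteq> num e \<Longrightarrow> p \<noteq> j \<Longrightarrow> row_at n (edge_reflection n e j) p 1 p"
proof -
  \<comment> \<open>Both entries carry the mark of \<open>e\<close>, so the two off-diagonal entries
    have the same sign.\<close>
  define c where "c = (if overlined e then [Over (num e), Over j] else [Plain (num e), Plain j])"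
  have eq: "edge_reflection n e j = cycle_mat n c"
    by (simp add: edge_reflection_def c_def reflection_def reflection_bar_def)
  have mc: "marked_cycle n c"
    using assms by (auto simp: c_def marked_cycle_def support_def)
  show "row_at n (edge_reflection n e j) (num e) (entry_sign e) j"
    using row_at_cycle_mat[OF mc, of 0]
    by (auto simp: eq c_def entry_sign_def split: if_splits)
  show "row_at n (edge_reflection n e j) j (entry_sign e) (num e)"
    using row_at_cycle_mat[OF mc, of 1]
    by (auto simp: eq c_def entry_sign_def split: if_splits)
  show "row_at n (edge_reflection n e j) p 1 p"
    if "p \<in> {1..n}" "p \<noteq> num e" "p \<noteq> j"
    using row_at_cycle_mat_outside[of p n c] that
    by (auto simp: eq c_def support_def split: if_splits)
qed

section \<open>Words of reflections and membership in \<open>W_D\<close>\<close>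

lemma word_prod_Nil [simp]: "word_prod n [] = 1\<^sub>m n"
  by (simp add: word_prod_def)

lemma word_prod_Cons [simp]: "word_prod n (t # ts) = t * word_prod n ts"
  by (simp add: word_prod_def)

lemma reflections_carrier: "reflections n \<subseteq> carrier_mat n n"
  by (auto simp: reflections_eq)

lemma word_prod_carrier [simp]:
  "set ts \<subseteq> carrier_mat n n \<Longrightarrow> word_prod n ts \<in> carrier_mat n n"
  by (induction ts) auto

lemma word_prod_append:
  "set ts \<subseteq> carrier_mat n n \<Longrightarrow> set us \<subseteq> carrier_mat n n \<Longrightarrow>
   word_prod n (ts @ us) = word_prod n ts * word_prod n us"
  by (induction ts) (auto simp: assoc_mult_mat[of _ n n _ n _ n] left_mult_one_mat[of _ n n])

text \<open>Explicit witnesses for the permutation and the row signs reduce closure under products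
  to a reindexing of the sign product.\<close>

definition signed_perm :: "nat \<Rightarrow> real mat \<Rightarrow> bool" where
  "signed_perm n A \<longleftrightarrow> A \<in> carrier_mat n n \<and> (\<exists>\<sigma> s. \<sigma> permutes {1..n} \<and>
     (\<forall>p\<in>{1..n}. row_at n A p (s p) (\<sigma> p) \<and> (s p = 1 \<or> s p = -1)) \<and> (\<Prod>p\<in>{1..n}. s p) = 1)"

text \<open>The nonzero positions form the graph of \<open>\<sigma>\<close>. Bijectivity gives one
  entry per row and column, and the product over these positions becomes the product of the row
  signs.\<close>

lemma signed_perm_in_W_D:
  assumes "signed_perm n A"
  shows "A \<in> W_D n"
proof -
  obtain \<sigma> s where A: "A \<in> carrier_mat n n" and \<sigma>: "\<sigma> permutes {1..n}"
    and rows: "\<And>p. p \<in> {1..n} \<Longrightarrow> row_at n A p (s p) (\<sigma> p)"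
    and s: "\<And>p. p \<in> {1..n} \<Longrightarrow> s p = 1 \<or> s p = -1"
    and prod: "(\<Prod>p\<in>{1..n}. s p) = 1"
    using assms unfolding signed_perm_def by blast
  have entry: "A $$ (i, j) = (if Suc j = \<sigma> (Suc i) then s (Suc i) else 0)"
    if "i < n" "j < n" for i j
    using row_at_index[OF rows[of "Suc i"], of "Suc j"] that by simp
  have nz: "A $$ (i, j) \<noteq> 0 \<longleftrightarrow> Suc j = \<sigma> (Suc i)" if "i < n" "j < n" for i j
    using entry[OF that] s[of "Suc i"] that by auto
  have \<sigma>_range: "\<sigma> p \<in> {1..n}" if "p \<in> {1..n}" for p
    using permutes_in_image[OF \<sigma>] that by blast
  have col: "\<exists>!j. j < n \<and> A $$ (i, j) \<noteq> 0" if "i < n" for i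
  proof (rule ex1I[of _ "\<sigma> (Suc i) - 1"])
    show "\<sigma> (Suc i) - 1 < n \<and> A $$ (i, \<sigma> (Suc i) - 1) \<noteq> 0"
      using nz[OF that, of "\<sigma> (Suc i) - 1"] \<sigma>_range[of "Suc i"] that
      by (cases "\<sigma> (Suc i)") auto
  qed (use nz[OF that] in \<open>metis diff_Suc_1\<close>)
  have row: "\<exists>!i. i < n \<and> A $$ (i, j) \<noteq> 0" if "j < n" for j
  proof -
    have "Suc j \<in> \<sigma> ` {1..n}"
      unfolding permutes_image[OF \<sigma>] using that by simp
    then obtain p where p: "p \<in> {1..n}" "\<sigma> p = Suc j"
      by (metis imageE)
    show ?thesis
    proof (rule ex1I[of _ "p - 1"])
      show "p - 1 < n \<and> A $$ (p - 1, j) \<noteq> 0"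
        using nz[of "p - 1" j] p that by (cases p) auto
    next
      fix i assume "i < n \<and> A $$ (i, j) \<noteq> 0"
      then have "\<sigma> (Suc i) = \<sigma> p" using nz[of i j] p that by auto
      then show "i = p - 1" using injD[OF permutes_inj[OF \<sigma>]] by (metis diff_Suc_1)
    qed
  qed
  have pos: "nonzero_positions n A = (\<lambda>p. (p - 1, \<sigma> p - 1)) ` {1..n}" (is "_ = ?f ` _")
  proof (intro equalityI subsetI)
    fix ij assume "ij \<in> nonzero_positions n A"
    then obtain i j where ij: "ij = (i, j)" "i < n" "j < n" "A $$ (i, j) \<noteq> 0"
      by (auto simp: nonzero_positions_def)
    with nz have "Suc j = \<sigma> (Suc i)" by blast
    then have "ij = ?f (Suc i)" using ij by (simp flip: \<open>Suc j = \<sigma> (Suc i)\<close>)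
    moreover have "Suc i \<in> {1..n}" using ij by simp
    ultimately show "ij \<in> ?f ` {1..n}" by (rule image_eqI)
  next
    fix ij assume "ij \<in> ?f ` {1..n}"
    then obtain p where p: "ij = (p - 1, \<sigma> p - 1)" "p \<in> {1..n}" by blast
    moreover have "p - 1 < n" "\<sigma> p - 1 < n" "Suc (p - 1) = p" "Suc (\<sigma> p - 1) = \<sigma> p"
      using p \<sigma>_range[of p] by auto
    ultimately show "ij \<in> nonzero_positions n A"
      using nz[of "p - 1" "\<sigma> p - 1"] by (simp add: nonzero_positions_def)
  qed
  \<comment> \<open>The first coordinate already separates the positions, as \<open>p - 1\<close> is
    injective on positive \<open>p\<close>.\<close>
  have inj: "inj_on ?f {1..n}"
    by (rule inj_onI) auto
  have val: "A $$ ?f p = s p" if "p \<in> {1..n}" for p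
    using row_at_index[OF rows[OF that] \<sigma>_range[OF that]] by simp
  have "(\<Prod>ij \<in> nonzero_positions n A. A $$ ij) = 1"
    using val prod unfolding pos prod.reindex[OF inj] by simp
  moreover have "\<forall>ij \<in> nonzero_positions n A. A $$ ij = 1 \<or> A $$ ij = -1"
    using val s by (simp add: pos)
  ultimately show ?thesis
    using A row col by (simp add: W_D_def monomial_mat_def)
qed

lemma signed_perm_mult:
  assumes "signed_perm n A" "signed_perm n B"
  shows "signed_perm n (A * B)"
proof -
  obtain \<sigma> s where A: "A \<in> carrier_mat n n" "\<sigma> permutes {1..n}"
    "\<And>p. p \<in> {1..n} \<Longrightarrow> row_at n A p (s p) (\<sigma> p)"
    "\<And>p. p \<in> {1..n} \<Longrightarrow> s p = 1 \<or> s p = -1" "(\<Prod>p\<in>{1..n}. s p) = 1"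
    using assms(1) unfolding signed_perm_def by blast
  obtain \<tau> t where B: "B \<in> carrier_mat n n" "\<tau> permutes {1..n}"
    "\<And>p. p \<in> {1..n} \<Longrightarrow> row_at n B p (t p) (\<tau> p)"
    "\<And>p. p \<in> {1..n} \<Longrightarrow> t p = 1 \<or> t p = -1" "(\<Prod>p\<in>{1..n}. t p) = 1"
    using assms(2) unfolding signed_perm_def by blast
  have \<sigma>_range: "\<sigma> p \<in> {1..n}" if "p \<in> {1..n}" for p
    using permutes_in_image[OF A(2)] that by blast
  \<comment> \<open>In \<open>A * B\<close> the rows of \<open>B\<close> are visited in the order
    given by \<open>\<sigma>\<close>, which leaves the product of their signs unchanged.\<close>
  have "(\<Prod>p\<in>{1..n}. t (\<sigma> p)) = (\<Prod>p\<in>{1..n}. t p)"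
    using prod.permute[OF A(2), of t] by (simp add: comp_def)
  then have "(\<Prod>p\<in>{1..n}. s p * t (\<sigma> p)) = 1"
    using A(5) B(5) by (simp add: prod.distrib)
  moreover have "row_at n (A * B) p (s p * t (\<sigma> p)) ((\<tau> \<circ> \<sigma>) p)
      \<and> (s p * t (\<sigma> p) = 1 \<or> s p * t (\<sigma> p) = -1)" if "p \<in> {1..n}" for p
    using row_at_mult[OF A(3)[OF that] B(3)[OF \<sigma>_range[OF that]]]
      A(4)[OF that] B(4)[OF \<sigma>_range[OF that]] by auto
  ultimately show ?thesis
    unfolding signed_perm_def using permutes_compose[OF A(2) B(2)] A(1) B(1)
    by (intro conjI exI[of _ "\<tau> \<circ> \<sigma>"] exI[of _ "\<lambda>p. s p * t (\<sigma> p)"]) auto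
qed

lemma signed_perm_one: "signed_perm n (1\<^sub>m n)"
  unfolding signed_perm_def
  by (intro conjI exI[of _ id] exI[of _ "\<lambda>_. 1"]) (auto simp: permutes_id row_at_one)

lemma signed_perm_reflection:
  assumes "t \<in> reflections n"
  shows "signed_perm n t"
proof -
  obtain e j where t: "t = edge_reflection n e j" and e: "num e \<in> {1..n}" "j \<in> {1..n}" "num e \<noteq> j"
    using assms by (auto simp: reflections_eq)
  let ?\<sigma> = "Transposition.transpose (num e) j"
  let ?s = "\<lambda>p. if p \<in> {num e, j} then entry_sign e else 1"
  \<comment> \<open>Only the two swapped rows can be negative, and they share the sign of
    \<open>e\<close>, so the product is a square.\<close>
  have "(\<Prod>p\<in>{1..n}. ?s p) = (\<Prod>p\<in>{num e, j}. ?s p)"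
    by (rule prod.mono_neutral_right) (use e in auto)
  also have "\<dots> = 1" using e by (simp add: entry_sign_sq)
  finally have "(\<Prod>p\<in>{1..n}. ?s p) = 1" .
  moreover have "row_at n t p (?s p) (?\<sigma> p)" if "p \<in> {1..n}" for p
    using row_at_edge_reflection[OF e] that e(3)
    by (cases "p = num e"; cases "p = j") (auto simp: t)
  ultimately show ?thesis
    unfolding signed_perm_def using permutes_swap_id[OF e(1,2)] entry_sign_cases
    by (intro conjI exI[of _ ?\<sigma>] exI[of _ ?s]) (auto simp: t)
qed

lemma word_prod_reflections_in_W_D:
  assumes "set ts \<subseteq> reflections n"
  shows "word_prod n ts \<in> W_D n"
proof -
  have "signed_perm n (word_prod n ts)"
    using assms
    by (induction ts) (auto intro: signed_perm_one signed_perm_mult signed_perm_reflection)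
  then show ?thesis by (rule signed_perm_in_W_D)
qed

section \<open>Fixed vectors and the lower bound on the length\<close>

text \<open>The functional is the root of the reflection: it vanishes exactly when the two swapped
  coordinates agree up to the sign of the reflection.\<close>

lemma reflection_fixes_hyperplane:
  assumes "t \<in> reflections n"
  shows "\<exists>f\<in>carrier_vec n. \<forall>v\<in>carrier_vec n. f \<bullet> v = 0 \<longrightarrow> t *\<^sub>v v = v"
proof -
  obtain e j where t: "t = edge_reflection n e j" and e: "num e \<in> {1..n}" "j \<in> {1..n}" "num e \<noteq> j"
    using assms by (auto simp: reflections_eq)
  define f :: "real vec" where "f = unit_vec n (num e - 1) - entry_sign e \<cdot>\<^sub>v unit_vec n (j - 1)"
  have fixed: "t *\<^sub>v v = v" if v: "v \<in> carrier_vec n" and fv: "f \<bullet> v = 0" for v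
  proof -
    have "f \<bullet> v = v $ (num e - 1) - entry_sign e * v $ (j - 1)"
      using e v unfolding f_def by (subst minus_scalar_prod_distrib[of _ n]) auto
    with fv have eq: "v $ (num e - 1) = entry_sign e * v $ (j - 1)" by simp
    then have eq': "v $ (j - 1) = entry_sign e * v $ (num e - 1)"
      using entry_sign_sq[of e] by (simp flip: mult.assoc)
    show ?thesis
    proof (rule eq_vecI)
      fix i assume "i < dim_vec v"
      then have p: "Suc i \<in> {1..n}" using v by auto
      consider "Suc i = num e" | "Suc i = j" | "Suc i \<noteq> num e" "Suc i \<noteq> j" by blast
      then show "(t *\<^sub>v v) $ i = v $ i"
      proof cases
        case 1
        then show ?thesis
          using row_at_mult_vec[OF row_at_edge_reflection(1)[OF e] v] eq by (simp add: t flip: 1)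
      next
        case 2
        then show ?thesis
          using row_at_mult_vec[OF row_at_edge_reflection(2)[OF e] v] eq' by (simp add: t flip: 2)
      next
        case 3
        then show ?thesis
          using row_at_mult_vec[OF row_at_edge_reflection(3)[OF e p] v] by (simp add: t)
      qed
    qed (use v in \<open>simp add: t carrier_matD[OF edge_reflection_carrier]\<close>)
  qed
  moreover have "f \<in> carrier_vec n" by (simp add: f_def)
  ultimately show ?thesis by blast
qed

text \<open>A vector killed by one functional per factor is fixed by every factor, hence by the
  product. The functionals may repeat or be dependent, since only their number is counted.\<close>

lemma word_prod_fixes_codim:
  assumes "set ts \<subseteq> reflections n"
  shows "\<exists>fs. length fs = length ts \<and> set fs \<subseteq> carrier_vec n \<and>
    (\<forall>v\<in>carrier_vec n. (\<forall>f\<in>set fs. f \<bullet> v = 0) \<longrightarrow> word_prod n ts *\<^sub>v v = v)"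
  using assms
proof (induction ts)
  case Nil
  show ?case by (rule exI[of _ "[]"]) simp
next
  case (Cons t ts)
  then have t: "t \<in> carrier_mat n n" and ts: "word_prod n ts \<in> carrier_mat n n"
    using reflections_carrier[of n] by (auto intro!: word_prod_carrier)
  obtain fs where fs: "length fs = length ts" "set fs \<subseteq> carrier_vec n"
    "\<And>v. v \<in> carrier_vec n \<Longrightarrow> \<forall>f\<in>set fs. f \<bullet> v = 0 \<Longrightarrow> word_prod n ts *\<^sub>v v = v"
    using Cons by auto
  obtain f where f: "f \<in> carrier_vec n"
    "\<And>v. v \<in> carrier_vec n \<Longrightarrow> f \<bullet> v = 0 \<Longrightarrow> t *\<^sub>v v = v"
    using reflection_fixes_hyperplane[of t n] Cons.prems by auto
  have "word_prod n (t # ts) *\<^sub>v v = v"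
    if "v \<in> carrier_vec n" "\<forall>g\<in>set (f # fs). g \<bullet> v = 0" for v
    using that fs(3)[of v] f(2)[of v] assoc_mult_mat_vec[OF t ts, of v] by simp
  then show ?case
    using fs f by (intro exI[of _ "f # fs"]) auto
qed

text \<open>Padding the functionals with zero vectors gives a singular square matrix, and a nonzero
  kernel vector of it is a common zero.\<close>

lemma common_zero_of_few_functionals:
  fixes fs :: "real vec list"
  assumes "length fs < n" "set fs \<subseteq> carrier_vec n"
  shows "\<exists>v\<in>carrier_vec n. v \<noteq> 0\<^sub>v n \<and> (\<forall>f\<in>set fs. f \<bullet> v = 0)"
proof -
  define gs where "gs = fs @ replicate (n - length fs) (0\<^sub>v n)"
  define A where "A = mat_of_rows n gs"
  have len: "length gs = n" using assms by (simp add: gs_def)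
  have gs: "set gs \<subseteq> carrier_vec n" using assms by (auto simp: gs_def)
  have A: "A \<in> carrier_mat n n" using mat_of_rows_carrier(1)[of n gs] by (simp add: A_def len)
  have rows: "row A i = gs ! i" if "i < n" for i
    using that len gs by (simp add: A_def subset_code(1))
  \<comment> \<open>The strict bound on \<open>length fs\<close> ensures a padding row; the first
    one has index \<open>length fs\<close>.\<close>
  have "row A (length fs) = 0\<^sub>v n"
    using rows[OF assms(1)] assms(1) by (simp add: gs_def nth_append)
  then have "A = mat\<^sub>r n n (\<lambda>i. if i = length fs then 0\<^sub>v n else row A i)"
    using A by (intro eq_rowI) auto
  then have "det A = 0"
    using det_row_0[OF assms(1), of "row A"] A by auto
  then obtain v where v: "v \<in> carrier_vec n" "v \<noteq> 0\<^sub>v n" "A *\<^sub>v v = 0\<^sub>v n"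
    using det_0_iff_vec_prod_zero[OF A] by blast
  have "f \<bullet> v = 0" if f: "f \<in> set fs" for f
  proof -
    obtain i where i: "i < length fs" "f = fs ! i" using f by (metis in_set_conv_nth)
    then have "f = row A i" using rows[of i] assms(1) by (simp add: gs_def nth_append)
    then have "f \<bullet> v = (A *\<^sub>v v) $ i" using A i assms(1) by simp
    then show ?thesis using v(3) i assms(1) by simp
  qed
  then show ?thesis using v by blast
qed

text \<open>By \<open>trivial\<close>, the fixed space has dimension at most one. With fewer than
  \<open>n - 1\<close> factors, their functionals together with \<open>g\<close> would number fewer
  than \<open>n\<close> and have a nonzero common zero, which the word would fix.\<close>

lemma length_ge_if_fixed_points_few:
  assumes ts: "set ts \<subseteq> reflections n" and g: "g \<in> carrier_vec n"
    and trivial: "\<And>v. v \<in> carrier_vec n \<Longrightarrow> word_prod n ts *\<^sub>v v = v \<Longrightarrow> g \<bullet> v = 0 \<Longrightarrow> v = 0\<^sub>v n"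
  shows "n - 1 \<le> length ts"
proof (rule ccontr)
  assume "\<not> n - 1 \<le> length ts"
  obtain fs where fs: "length fs = length ts" "set fs \<subseteq> carrier_vec n"
    "\<And>v. v \<in> carrier_vec n \<Longrightarrow> \<forall>f\<in>set fs. f \<bullet> v = 0 \<Longrightarrow> word_prod n ts *\<^sub>v v = v"
    using word_prod_fixes_codim[OF ts] by blast
  have "length (g # fs) < n" "set (g # fs) \<subseteq> carrier_vec n"
    using \<open>\<not> n - 1 \<le> length ts\<close> fs g by auto
  from common_zero_of_few_functionals[OF this] obtain v
    where "v \<in> carrier_vec n" "v \<noteq> 0\<^sub>v n" "\<forall>f\<in>set (g # fs). f \<bullet> v = 0" by blast
  with fs(3) trivial show False by auto
qed

section \<open>The product of the reflections of one cycle\<close>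

text \<open>Turns the indexed list into a recursion along the cycle, as needed for induction on its
  entries.\<close>

lemma cycle_reflections_Cons:
  "cycle_reflections n (e # f # c) = edge_reflection n e (num f) # cycle_reflections n (f # c)"
proof -
  have "[0..<Suc (length c)] = 0 # map Suc [0..<length c]"
    by (simp add: upt_conv_Cons map_Suc_upt del: upt_Suc)
  then show ?thesis
    by (simp add: cycle_reflections_def edge_reflection_def comp_def del: upt_Suc)
qed

lemma cycle_reflections_single: "cycle_reflections n [e] = []"
  by (simp add: cycle_reflections_def)

lemma cycle_reflections_subset:
  "marked_cycle n c \<Longrightarrow> set (cycle_reflections n c) \<subseteq> reflections n"
proof (induction c rule: induct_list012)
  case (3 e f c)
  then have "marked_cycle n (f # c)" "num e \<in> {1..n}" "num f \<in> {1..n}" "num e \<noteq> num f"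
    by (auto simp: marked_cycle_def support_def)
  with 3 show ?case by (auto simp: cycle_reflections_Cons reflections_eq)
qed (simp_all add: cycle_reflections_single marked_cycle_def)

text \<open>By induction: a new head entry multiplies the word by one reflection on the right. This
  gives the new head a row leading to the old head, and redirects the closing row from the old head
  to the new one with one more sign. Thus the signs before the last entry accumulate in the closing
  row.\<close>

lemma word_prod_rev_cycle_reflections:
  assumes "marked_cycle n c"
  defines "P \<equiv> word_prod n (rev (cycle_reflections n c))"
  shows "(\<forall>a. Suc a < length c \<longrightarrow> row_at n P (num (c ! a)) (entry_sign (c ! a)) (num (c ! Suc a)))
    \<and> row_at n P (num (last c)) (prod_list (map entry_sign (butlast c))) (num (hd c))
    \<and> (\<forall>p\<in>{1..n}. p \<notin> support c \<longrightarrow> row_at n P p 1 p)"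
  using assms(1) unfolding P_def
proof (induction c rule: induct_list012)
  case 1
  then show ?case by (simp add: marked_cycle_def)
next
  case (2 e)
  then show ?case
    by (auto simp: cycle_reflections_single marked_cycle_def support_def intro: row_at_one)
next
  case (3 e f c)
  let ?R = "edge_reflection n e (num f)"
  let ?Q = "word_prod n (rev (cycle_reflections n (f # c)))"
  have mc: "marked_cycle n (f # c)" and e: "num e \<in> {1..n}" "num f \<in> {1..n}" "num e \<noteq> num f"
    and e_out: "num e \<notin> support (f # c)"
    using "3.prems" by (auto simp: marked_cycle_def support_def)
  have dist: "distinct (map num (f # c))" "support (f # c) \<subseteq> {1..n}"
    using mc by (simp_all add: marked_cycle_def)
  have "set (cycle_reflections n (f # c)) \<subseteq> carrier_mat n n"
    using cycle_reflections_subset[OF mc] reflections_carrier by blast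
  \<comment> \<open>Reversal moves the reflection of the first edge to the right end of the
    word.\<close>
  then have P: "word_prod n (rev (cycle_reflections n (e # f # c))) = ?Q * ?R"
    by (simp add: cycle_reflections_Cons word_prod_append carrier_matD[OF edge_reflection_carrier]
        right_mult_one_mat')
  note R = row_at_edge_reflection[OF e]
  have IH1: "\<And>a. Suc a < length (f # c) \<Longrightarrow>
      row_at n ?Q (num ((f # c) ! a)) (entry_sign ((f # c) ! a)) (num ((f # c) ! Suc a))"
    and IH2: "row_at n ?Q (num (last (f # c)))
      (prod_list (map entry_sign (butlast (f # c)))) (num f)"
    and IH3: "\<And>p. p \<in> {1..n} \<Longrightarrow> p \<notin> support (f # c) \<Longrightarrow> row_at n ?Q p 1 p"
    using "3.IH"(2)[OF mc] by auto
  have "row_at n (?Q * ?R) (num ((e # f # c) ! a)) (entry_sign ((e # f # c) ! a))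
      (num ((e # f # c) ! Suc a))" if a: "Suc a < length (e # f # c)" for a
  proof (cases a)
    case 0
    then show ?thesis
      using row_at_mult[OF IH3[OF e(1) e_out] R(1)] by simp
  next
    case (Suc b)
    let ?q = "num ((f # c) ! Suc b)"
    have b: "Suc b < length (f # c)" using a Suc by simp
    \<comment> \<open>An inner target is neither of the positions swapped by \<open>?R\<close>: it
      comes after the head \<open>f\<close>, and \<open>num e\<close> does not occur in
      \<open>f # c\<close>.\<close>
    have "?q \<in> support (f # c)" using b by (auto simp: support_def)
    then have "?q \<in> {1..n}" "?q \<noteq> num e" using dist(2) e_out by auto
    moreover have "?q \<noteq> num f"
      using dist(1) b by (auto simp: image_iff) (metis nth_mem)
    ultimately show ?thesis
      using row_at_mult[OF IH1[OF b] R(3)[of ?q]] Suc by simp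
  qed
  \<comment> \<open>\<open>?Q\<close> leads the last position back to \<open>num f\<close>, and
    \<open>?R\<close> carries it on to \<open>num e\<close>, contributing the sign of
    \<open>e\<close>.\<close>
  moreover have "row_at n (?Q * ?R) (num (last (e # f # c)))
      (prod_list (map entry_sign (butlast (e # f # c)))) (num (hd (e # f # c)))"
    using row_at_mult[OF IH2 R(2)] by (simp add: mult.commute)
  moreover have "row_at n (?Q * ?R) p 1 p" if "p \<in> {1..n}" "p \<notin> support (e # f # c)" for p
  proof -
    have "p \<notin> support (f # c)" "p \<noteq> num e" "p \<noteq> num f"
      using that by (auto simp: support_def)
    then show ?thesis
      using row_at_mult[OF IH3[of p] R(3)[of p]] that by simp
  qed
  ultimately show ?case unfolding P by blast
qed

section \<open>Signs and fixed vectors of a single cycle\<close>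

lemma prod_list_entry_sign: "prod_list (map entry_sign c) = (-1) ^ num_overlined c"
  by (induction c) (auto simp: num_overlined_def entry_sign_def)

lemma row_at_cycle_mat_Suc:
  assumes "marked_cycle n c" "Suc a < length c"
  shows "row_at n (cycle_mat n c) (num (c ! a)) (entry_sign (c ! a)) (num (c ! Suc a))"
  using row_at_cycle_mat[OF assms(1), of a] assms(2) by simp

lemma row_at_cycle_mat_last:
  assumes "marked_cycle n c"
  shows "row_at n (cycle_mat n c) (num (last c)) (entry_sign (last c)) (num (hd c))"
proof -
  have "c \<noteq> []" using assms by (simp add: marked_cycle_def)
  then show ?thesis
    using row_at_cycle_mat[OF assms, of "length c - 1"] by (simp add: last_conv_nth hd_conv_nth)
qed

lemma support_cases:
  assumes "p \<in> support c"
  obtains a where "Suc a < length c" "p = num (c ! a)" | "p = num (last c)"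
proof -
  obtain a where a: "a < length c" "p = num (c ! a)"
    using assms by (auto simp: support_def in_set_conv_nth)
  show thesis
  proof (cases "Suc a < length c")
    case False
    then have "a = length c - 1" "c \<noteq> []" using a by auto
    then show thesis using a that(2) by (simp add: last_conv_nth)
  qed (use a that(1) in blast)
qed

lemma num_nth_in_support: "a < length c \<Longrightarrow> num (c ! a) \<in> support c"
  by (auto simp: support_def)

lemma ends_in_support:
  assumes "marked_cycle n c"
  shows "num (last c) \<in> support c" "num (hd c) \<in> support c"
  using assms by (auto simp: marked_cycle_def support_def)

lemma num_nth_neq_last:
  assumes "marked_cycle n c" "Suc a < length c"
  shows "num (c ! a) \<noteq> num (last c)"
proof -
  have "c \<noteq> []" using assms(2) by auto
  then have "num (c ! a) = map num c ! a" "num (last c) = map num c ! (length c - 1)"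
    using assms(2) by (simp_all add: last_conv_nth)
  moreover have "a \<noteq> length c - 1" "a < length (map num c)" "length c - 1 < length (map num c)"
    using assms(2) by auto
  ultimately show ?thesis
    using assms(1) by (metis marked_cycle_def nth_eq_iff_index_eq)
qed

text \<open>The product of all signs is the parity sign, and the product of those before the last is
  its own inverse. This relates the closing row of a cycle matrix to that of the reflection
  word.\<close>

lemma entry_sign_last:
  assumes "c \<noteq> []"
  shows "entry_sign (last c) = (-1) ^ num_overlined c * prod_list (map entry_sign (butlast c))"
proof -
  let ?b = "prod_list (map entry_sign (butlast c))"
  have prod: "(-1) ^ num_overlined c = ?b * entry_sign (last c)"
    using arg_cong[OF append_butlast_last_id[OF assms], of "\<lambda>c. prod_list (map entry_sign c)"]
    unfolding prod_list_entry_sign[of c, symmetric] by simp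
  have "?b * ?b = 1"
    by (simp add: prod_list_entry_sign flip: power_mult_distrib)
  then have "entry_sign (last c) = ?b * ?b * entry_sign (last c)" by simp
  then show ?thesis
    unfolding prod by (simp only: ac_simps)
qed

lemma card_support: "marked_cycle n c \<Longrightarrow> card (support c) = length c"
  by (metis distinct_card length_map list.set_map marked_cycle_def support_def)

text \<open>Each row relation expresses a coordinate by the next one up to sign, so vanishing
  spreads backwards from the last entry through the whole cycle, whatever the marks.\<close>

lemma zero_on_support_if_zero_at_last:
  assumes c: "marked_cycle n c" and v: "v \<in> carrier_vec n"
    and rows: "\<And>p s q. p \<in> support c \<Longrightarrow> q \<in> support c \<Longrightarrow>
      row_at n (cycle_mat n c) p s q \<Longrightarrow> v $ (p - 1) = s * v $ (q - 1)"
    and last: "v $ (num (last c) - 1) = 0" and p: "p \<in> support c"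
  shows "v $ (p - 1) = 0"
proof -
  have "v $ (num (c ! a) - 1) = 0" if "a \<le> length c - 1" for a
    using that
  \<comment> \<open>\<open>inc_induct\<close> descends from the last index, which is the direction
    of the row relations.\<close>
  proof (induction a rule: inc_induct)
    case base
    have "c \<noteq> []" using c by (simp add: marked_cycle_def)
    then show ?case using last by (simp add: last_conv_nth)
  next
    case (step a)
    then have "Suc a < length c" by simp
    then show ?case
      using rows[OF num_nth_in_support num_nth_in_support row_at_cycle_mat_Suc[OF c]] step by simp
  qed
  moreover obtain a where "a < length c" "p = num (c ! a)"
    using p by (auto simp: support_def in_set_conv_nth)
  ultimately show ?thesis by simp
qed

lemma not_overlined_if_not_last:
  assumes "num_overlined c = 1" "overlined (last c)" "Suc a < length c"
  shows "\<not> overlined (c ! a)"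
proof -
  have "c = butlast c @ [last c]"
    using assms(3) by (metis append_butlast_last_id list.size(3) not_less_zero)
  then have "length (filter overlined (butlast c @ [last c])) = 1"
    using assms(1) by (simp add: num_overlined_def)
  then have "filter overlined (butlast c) = []" using assms(2) by simp
  moreover have "c ! a \<in> set (butlast c)"
    using assms(3) nth_mem[of a "butlast c"] by (simp add: nth_butlast)
  ultimately show ?thesis by (simp add: filter_empty_conv)
qed

text \<open>The rows before the last are plain and make all coordinates on the cycle equal; the
  closing row then equates the common value with its negative. In a 1-cycle the closing row alone
  does this.\<close>

lemma zero_at_last_if_one_overlined:
  assumes c: "marked_cycle n c" and odd: "num_overlined c = 1" and over: "overlined (last c)"
    and rows: "\<And>p s q. p \<in> support c \<Longrightarrow> q \<in> support c \<Longrightarrow>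
      row_at n (cycle_mat n c) p s q \<Longrightarrow> v $ (p - 1) = s * v $ (q - 1)"
  shows "v $ (num (last c) - 1) = (0::real)"
proof -
  have ne: "c \<noteq> []" using c by (simp add: marked_cycle_def)
  have plain: "entry_sign (c ! a) = 1" if "Suc a < length c" for a
    using not_overlined_if_not_last[OF odd over that] by (simp add: entry_sign_def)
  have "v $ (num (c ! a) - 1) = v $ (num (last c) - 1)" if "a \<le> length c - 1" for a
    using that
  proof (induction a rule: inc_induct)
    case base
    show ?case using ne by (simp add: last_conv_nth)
  next
    case (step a)
    then have "Suc a < length c" by simp
    then show ?case
      using rows[OF num_nth_in_support num_nth_in_support row_at_cycle_mat_Suc[OF c]] step plain
      by simp
  qed
  from this[of 0] have "v $ (num (hd c) - 1) = v $ (num (last c) - 1)"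
    using ne by (simp add: hd_conv_nth)
  moreover have "v $ (num (last c) - 1) = - v $ (num (hd c) - 1)"
    using rows[OF ends_in_support[OF c] row_at_cycle_mat_last[OF c]] over
    by (simp add: entry_sign_def)
  ultimately show ?thesis by simp
qed

section \<open>Comparison of reflection words with cycles, and the correcting factor\<close>

text \<open>Both matrices follow the same permutation on the support. Their signs can differ only in
  the closing row, and there by the parity sign from \<open>entry_sign_last\<close>.\<close>

lemma row_at_word_prod_vs_cycle_mat:
  assumes c: "marked_cycle n c" and p: "p \<in> support c"
  shows "\<exists>s q. q \<in> support c \<and> row_at n (cycle_mat n c) p s q \<and>
    row_at n (word_prod n (rev (cycle_reflections n c))) p
      ((if p = num (last c) then (-1) ^ num_overlined c else 1) * s) q"
  using p
proof (cases rule: support_cases)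
  case (1 a)
  then show ?thesis
    using word_prod_rev_cycle_reflections[OF c] row_at_cycle_mat_Suc[OF c 1(1)]
      num_nth_neq_last[OF c 1(1)] num_nth_in_support[OF 1(1)] by auto
next
  case 2
  have "c \<noteq> []" using c by (simp add: marked_cycle_def)
  then have "(-1) ^ num_overlined c * entry_sign (last c) = prod_list (map entry_sign (butlast c))"
    using entry_sign_last[of c] by (cases "even (num_overlined c)") simp_all
  then show ?thesis
    using word_prod_rev_cycle_reflections[OF c] row_at_cycle_mat_last[OF c]
      ends_in_support(2)[OF c] 2
    by (intro exI[of _ "entry_sign (last c)"] exI[of _ "num (hd c)"]) auto
qed

text \<open>The two factors swap \<open>u\<close> and \<open>v\<close> twice, so every position
  returns to itself; for \<open>u\<close> and \<open>v\<close> only the second swap contributes a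
  sign -1.\<close>

lemma row_at_reflection_pair:
  assumes "u \<in> {1..n}" "v \<in> {1..n}" "u \<noteq> v" "p \<in> {1..n}"
  shows "row_at n (reflection n u v * reflection_bar n u v) p (if p = u \<or> p = v then -1 else 1) p"
proof -
  have eq: "reflection n u v = edge_reflection n (Plain u) v"
    "reflection_bar n u v = edge_reflection n (Over u) v"
    by (simp_all add: edge_reflection_def)
  have R: "row_at n (reflection n u v) u 1 v" "row_at n (reflection n u v) v 1 u"
    "row_at n (reflection_bar n u v) u (-1) v" "row_at n (reflection_bar n u v) v (-1) u"
    "p \<noteq> u \<Longrightarrow> p \<noteq> v \<Longrightarrow> row_at n (reflection n u v) p 1 p"
    "p \<noteq> u \<Longrightarrow> p \<noteq> v \<Longrightarrow> row_at n (reflection_bar n u v) p 1 p"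
    using row_at_edge_reflection(1,2)[of "Plain u" n v] row_at_edge_reflection(1,2)[of "Over u" n v]
      row_at_edge_reflection(3)[of "Plain u" n v p] row_at_edge_reflection(3)[of "Over u" n v p] assms
    by (simp_all add: eq entry_sign_def)
  show ?thesis
    using row_at_mult[OF R(1,4)] row_at_mult[OF R(2,3)] row_at_mult[OF R(5,6)] by auto
qed

theorem proposition4p11:
  fixes n m u v :: nat and w0 :: "real mat" and x y z :: "entry list"
  assumes "n \<ge> 4" and "1 \<le> m" and "m \<le> n div 2"
    and "type_II n m w0 \<or> type_III n m w0"
    and "marked_cycle n x" and "marked_cycle n y" and "marked_cycle n z"
    and "support x \<inter> support y = {}" and "support x \<inter> support z = {}"
    and "support y \<inter> support z = {}"
    and "length x + length y + length z = n"
    and "w0 = cycle_mat n x * cycle_mat n y * cycle_mat n z"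
    and "even (num_overlined z)"
    and "num_overlined x = 1" and "last x = Over u"
    and "num_overlined y = 1" and "last y = Over v"
    and "n \<in> support x \<union> support y \<longrightarrow> n \<in> support x"
  shows "reduced_decomposition n w0
    ([reflection n u v, reflection_bar n u v] @ rev (procedure_reflections n x y z))"
proof -
  note mc = assms(5-7) and disj = assms(8-10) and w0 = assms(12)
  let ?Cx = "cycle_mat n x" and ?Cy = "cycle_mat n y" and ?Cz = "cycle_mat n z"
  let ?P = "\<lambda>c. word_prod n (rev (cycle_reflections n c))"
  let ?Px = "?P x" and ?Py = "?P y" and ?Pz = "?P z"
  let ?D = "reflection n u v * reflection_bar n u v"
  let ?ts = "[reflection n u v, reflection_bar n u v] @ rev (procedure_reflections n x y z)"
  have sub: "support x \<subseteq> {1..n}" "support y \<subseteq> {1..n}" "support z \<subseteq> {1..n}"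
    using mc by (simp_all add: marked_cycle_def)
  have fin: "finite (support c)" for c by (simp add: support_def)
  \<comment> \<open>The supports are disjoint and their sizes are the cycle lengths, which add up to
    \<open>n\<close>; hence every position lies in one of the three cycles.\<close>
  have "card (support x \<union> support y \<union> support z) = n"
    using disj assms(11) mc by (simp add: card_Un_disjoint fin card_support Int_Un_distrib2)
  then have cover: "support x \<union> support y \<union> support z = {1..n}"
    using sub by (intro card_subset_eq) auto
  have u: "u = num (last x)" "u \<in> support x" and v: "v = num (last y)" "v \<in> support y"
    using ends_in_support(1)[OF mc(1)] ends_in_support(1)[OF mc(2)] assms(15,17) by simp_all
  then have uv: "u \<in> {1..n}" "v \<in> {1..n}" "u \<noteq> v"
    using sub disj by auto
  have neq: "x \<noteq> y" "x \<noteq> z" "y \<noteq> z"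
    using disj ends_in_support(1)[OF mc(1)] ends_in_support(1)[OF mc(2)] by auto
  \<comment> \<open>The factors to the left of the cycle \<open>c\<close> fix \<open>p\<close> and
    those to its right fix \<open>q\<close>, so only \<open>c\<close> itself acts.\<close>
  have w0_rows: "row_at n w0 p s q"
    if "c \<in> {x, y, z}" "p \<in> support c" "q \<in> support c" "row_at n (cycle_mat n c) p s q" for c p s q
  proof -
    have out: "row_at n (cycle_mat n d) r 1 r" if "r \<in> {p, q}" "d \<in> {x, y, z}" "d \<noteq> c" for d r
      using that \<open>c \<in> {x, y, z}\<close> \<open>p \<in> support c\<close> \<open>q \<in> support c\<close> sub disj
      by (intro row_at_cycle_mat_outside) auto
    consider "c = x" | "c = y" | "c = z" using \<open>c \<in> {x, y, z}\<close> by blast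
    then show ?thesis
    proof cases
      case 1
      then show ?thesis
        using row_at_mult[OF row_at_mult[OF that(4) out[of q y]] out[of q z]] neq by (simp add: w0)
    next
      case 2
      then show ?thesis
        using row_at_mult[OF row_at_mult[OF out[of p x] that(4)] out[of q z]] neq by (simp add: w0)
    next
      case 3
      then show ?thesis
        using row_at_mult[OF row_at_mult[OF out[of p x] out[of p y]] that(4)] neq by (simp add: w0)
    qed
  qed
  \<comment> \<open>The order \<open>y\<close>, \<open>x\<close>, \<open>z\<close> comes from
    reversing the procedure. The tracing is as for \<open>w0\<close>, since each word fixes the
    positions outside its cycle.\<close>
  have P_rows: "row_at n (?Py * (?Px * ?Pz)) p s q"
    if "c \<in> {x, y, z}" "p \<in> support c" "q \<in> support c" "row_at n (?P c) p s q" for c p s q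
  proof -
    have out: "row_at n (?P d) r 1 r" if "r \<in> {p, q}" "d \<in> {x, y, z}" "d \<noteq> c" for d r
    proof -
      have "marked_cycle n d" "r \<in> {1..n}" "r \<notin> support d"
        using that \<open>c \<in> {x, y, z}\<close> \<open>p \<in> support c\<close> \<open>q \<in> support c\<close> sub disj mc by auto
      then show ?thesis using word_prod_rev_cycle_reflections by blast
    qed
    consider "c = x" | "c = y" | "c = z" using \<open>c \<in> {x, y, z}\<close> by blast
    then show ?thesis
    proof cases
      case 1
      then show ?thesis
        using row_at_mult[OF out[of p y] row_at_mult[OF that(4) out[of q z]]] neq by simp
    next
      case 2
      then show ?thesis
        using row_at_mult[OF that(4) row_at_mult[OF out[of q x] out[of q z]]] neq by simp
    next
      case 3
      then show ?thesis
        using row_at_mult[OF out[of p y] row_at_mult[OF out[of p x] that(4)]] neq by simp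
    qed
  qed
  have refl: "set (cycle_reflections n c) \<subseteq> reflections n" if "c \<in> {x, y, z}" for c
    using that mc cycle_reflections_subset by auto
  then have carr: "set (cycle_reflections n c) \<subseteq> carrier_mat n n" if "c \<in> {x, y, z}" for c
    using that reflections_carrier by blast
  have Pc: "?Px \<in> carrier_mat n n" "?Py \<in> carrier_mat n n" "?Pz \<in> carrier_mat n n"
    using carr by simp_all
  have Rc: "reflection n u v \<in> carrier_mat n n" "reflection_bar n u v \<in> carrier_mat n n"
    by (simp_all add: reflection_def reflection_bar_def)
  have ts_refl: "set ?ts \<subseteq> reflections n"
    using refl uv by (auto simp: procedure_reflections_def reflections_def)
  have "word_prod n ?ts = reflection n u v * (reflection_bar n u v * (?Py * (?Px * ?Pz)))"
    using carr by (simp add: procedure_reflections_def word_prod_append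
        assoc_mult_mat[OF Pc(2,1,3)])
  also have "\<dots> = ?D * (?Py * (?Px * ?Pz))"
    using Pc by (intro assoc_mult_mat[OF Rc, symmetric]) auto
  also have "\<dots> = w0"
  proof (rule row_at_eqI)
    show "?D * (?Py * (?Px * ?Pz)) \<in> carrier_mat n n" using Rc Pc by auto
    show "w0 \<in> carrier_mat n n"
      unfolding w0
      by (rule mult_carrier_mat[OF mult_carrier_mat[OF cycle_mat_carrier cycle_mat_carrier]
            cycle_mat_carrier])
    fix p assume p: "p \<in> {1..n}"
    then have "p \<in> support x \<union> support y \<union> support z" by (simp only: cover)
    then obtain c where c: "c \<in> {x, y, z}" "p \<in> support c" by blast
    then have "marked_cycle n c" using mc by auto
    from row_at_word_prod_vs_cycle_mat[OF this c(2)] obtain s q where sq: "q \<in> support c"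
      "row_at n (cycle_mat n c) p s q"
      "row_at n (?P c) p ((if p = num (last c) then (-1) ^ num_overlined c else 1) * s) q" by blast
    \<comment> \<open>\<open>u\<close> and \<open>v\<close> are the last positions of
      \<open>x\<close> and \<open>y\<close>, where the parity sign is -1; at the last position of
      \<open>z\<close> it is 1. So \<open>?D\<close> has exactly the sign by which the word of
      \<open>c\<close> deviates, and the two cancel.\<close>
    have sign: "(if p = u \<or> p = v then -1 else 1)
        = (if p = num (last c) then (-1) ^ num_overlined c else (1::real))"
      using c disj u v assms(13,14,16) by auto
    have "row_at n (?D * (?Py * (?Px * ?Pz))) p s q"
      using row_at_mult[OF row_at_reflection_pair[OF uv p] P_rows[OF c sq(1,3)]]
      unfolding sign by (cases "even (num_overlined c)") (simp_all split: if_splits)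
    then show "\<exists>s q. row_at n (?D * (?Py * (?Px * ?Pz))) p s q \<and> row_at n w0 p s q"
      using w0_rows[OF c sq(1,2)] by blast
  qed
  finally have ts_prod: "word_prod n ?ts = w0" .
  \<comment> \<open>Two correcting factors, and for each of the three nonempty cycles one factor
    fewer than its length.\<close>
  have len: "length ?ts = n - 1"
  proof -
    have "length (cycle_reflections n c) = length c - 1" for c
      by (simp add: cycle_reflections_def)
    moreover have "length x \<ge> 1" "length y \<ge> 1" "length z \<ge> 1"
      using mc by (simp_all add: marked_cycle_def Suc_le_eq)
    ultimately show ?thesis
      using assms(11) by (simp add: procedure_reflections_def)
  qed
  have lower: "n - 1 \<le> length rs" if "set rs \<subseteq> reflections n" "word_prod n rs = w0" for rs
  proof (rule length_ge_if_fixed_points_few[OF that(1)])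
    \<comment> \<open>The extra functional reads the coordinate at the last entry of
      \<open>z\<close>; for \<open>x\<close> and \<open>y\<close> the coordinate at the last entry
      vanishes by the row relations alone.\<close>
    show "unit_vec n (num (last z) - 1) \<in> carrier_vec n" by simp
    fix a :: "real vec"
    assume a: "a \<in> carrier_vec n" and fixed: "word_prod n rs *\<^sub>v a = a"
      and z0: "unit_vec n (num (last z) - 1) \<bullet> a = 0"
    \<comment> \<open>Being fixed by \<open>w0\<close>, the vector satisfies one relation for each
      row of each of the three cycles.\<close>
    have rows: "a $ (p - 1) = s * a $ (q - 1)"
      if "c \<in> {x, y, z}" "p \<in> support c" "q \<in> support c" "row_at n (cycle_mat n c) p s q" for c p s q
      using row_at_mult_vec[OF w0_rows[OF that] a] fixed \<open>word_prod n rs = w0\<close> by simp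
    have "num (last z) \<in> {1..n}"
      using ends_in_support(1)[OF mc(3)] sub(3) by blast
    then have "num (last z) - 1 < n" by auto
    then have "a $ (num (last z) - 1) = 0"
      using z0 a by simp
    moreover have "a $ (num (last x) - 1) = 0"
      using zero_at_last_if_one_overlined[OF mc(1) assms(14)] rows[of x] assms(15) by simp
    moreover have "a $ (num (last y) - 1) = 0"
      using zero_at_last_if_one_overlined[OF mc(2) assms(16)] rows[of y] assms(17) by simp
    ultimately have zero: "a $ (p - 1) = 0" if "p \<in> {1..n}" for p
      using that cover zero_on_support_if_zero_at_last[OF mc(1) a rows[of x]]
        zero_on_support_if_zero_at_last[OF mc(2) a rows[of y]]
        zero_on_support_if_zero_at_last[OF mc(3) a rows[of z]] by blast
    show "a = 0\<^sub>v n"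
    proof (rule eq_vecI)
      fix i assume "i < dim_vec (0\<^sub>v n :: real vec)"
      then show "a $ i = 0\<^sub>v n $ i" using zero[of "Suc i"] by simp
    qed (use a in simp)
  qed
  have "reflection_length n w0 = n - 1"
    unfolding reflection_length_def
    using ts_refl ts_prod len lower by (intro Least_equality) blast+
  then show ?thesis
    using word_prod_reflections_in_W_D[OF ts_refl] ts_refl ts_prod len
    unfolding reduced_decomposition_def by simp
qed

end
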